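(* Let $\Bbbk$ be a field of characteristic zero, let $\psi$ be a colouring of $\mathbb B$ with values in $\Bbbk[[h]]$ and let $M=(M_p)_{p\in\mathbb N}$ be a sequence of elements of $\Bbbk[u][[h]]$ converging to $0$ in the $h$-adic topology. The following two assertions are equivalent. (i) The equality $X^+X^-=\sum_{a\in\mathbb N}(X^-)^a\,M_a(H)\,(X^+)^a$ holds in $U_h(\mathfrak{sl}_2,\psi)$. (ii) $M$ is a solution of the GQE equation $\mathscr E^{[-1]}_h(\psi,\psi)$.
   Context: Let $[E]=\{(n,k)\in\mathbb N^2 : 1\le k\le n\}$. A colouring of $\mathbb B$ with values in $\Bbbk[[h]]$ is a pair $\psi=(\psi^-,\psi^+)$ of functions $[E]\to\Bbbk[[h]]$. Put $[\psi](n,k)=\psi^-(n,k)\,\psi^+(n,n-k+1)$ for $(n,k)\in[E]$. Let $\mathfrak{sl}_{2,F}$ be the Lie $\Bbbk$-algebra generated by $X^-,X^+,H$ with relations $[H,X^\pm]=\pm2X^\pm$, and let $U_h(\mathfrak{sl}_{2,F})=U(\mathfrak{sl}_{2,F})[[h]]$ (formal power series with the $\Bbbk[[h]]$-bilinear extension of the product). For $n\in\mathbb N$, $L_h(n,\psi)$ is the representation of $U_h(\mathfrak{sl}_{2,F})$ on the free $\Bbbk[[h]]$-module with basis $b_{n,0},\dots,b_{n,n}$ given by $H.b_{n,p}=(n-2p)b_{n,p}$; $X^-.b_{n,p}=\psi^-(n,p+1)b_{n,p+1}$ if $p\ne n$ and $0$ if $p=n$; $X^+.b_{n,p}=\psi^+(n,n-p+1)b_{n,p-1}$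 if $p\neq0$ and $0$ if $p=0$. $U_h(\mathfrak{sl}_2,\psi)$ is the quotient of $U_h(\mathfrak{sl}_{2,F})$ by the two-sided ideal of elements acting by zero on all $L_h(n,\psi)$, $n\in\mathbb N$. It is $h$-adically separated and complete, so the series in (i) converges. A solution of $\mathscr E^{[-1]}_h(\psi,\psi)$ is a sequence $M=(M_p)_{p\in\mathbb N}$ of elements of $\Bbbk[u][[h]]$ converging $h$-adically to $0$ such that for all integers $0\le p\le n$: $$\sum_{a=0}^{p}\Big(\prod_{k=p-a+1}^{p}[\psi](n,k)\Big)M_a(n-2p+2a)=\begin{cases}[\psi](n,p+1)&\text{if }p+1\le n,\\0&\text{if }p=n.\end{cases}$$ For $P=\sum_mP_mh^m\in\Bbbk[u][[h]]$, $P(n)=\sum_mP_m(n)h^m$, and $P(H)=\sum_m P_m(H)h^m$. Empty products equal $1$. *)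

theory Defs
  imports
    "HOL-Algebra.Algebraic_Closure_Type"
    "HOL-Algebra.QuotRing"
begin

section \<open>The Lie algebra with generators X-, X+, H and relations [H, X\<plusminus>] = \<plusminus>2 X\<plusminus>\<close>

datatype sl2_gen = Xminus | Xplus | Hgen

datatype 'k lie_exp =
    LGen sl2_gen
  | LZero
  | LAdd "'k lie_exp" "'k lie_exp"
  | LScale 'k "'k lie_exp"
  | LBr "'k lie_exp" "'k lie_exp"

text \<open>
  The least congruence on Lie expressions containing the Lie algebra axioms and the
  two defining relations.
\<close>

inductive lie_eq :: "'k::field lie_exp \<Rightarrow> 'k lie_exp \<Rightarrow> bool" where
  refl: "lie_eq x x"
| sym: "lie_eq x y \<Longrightarrow> lie_eq y x"
| trans: "lie_eq x y \<Longrightarrow> lie_eq y z \<Longrightarrow> lie_eq x z"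
| cong_add: "lie_eq x x' \<Longrightarrow> lie_eq y y' \<Longrightarrow> lie_eq (LAdd x y) (LAdd x' y')"
| cong_scale: "lie_eq x x' \<Longrightarrow> lie_eq (LScale c x) (LScale c x')"
| cong_br: "lie_eq x x' \<Longrightarrow> lie_eq y y' \<Longrightarrow> lie_eq (LBr x y) (LBr x' y')"
| add_assoc: "lie_eq (LAdd (LAdd x y) z) (LAdd x (LAdd y z))"
| add_comm: "lie_eq (LAdd x y) (LAdd y x)"
| add_zero: "lie_eq (LAdd LZero x) x"
| add_inv: "lie_eq (LAdd (LScale (-1) x) x) LZero"
| scale_add_right: "lie_eq (LScale c (LAdd x y)) (LAdd (LScale c x) (LScale c y))"
| scale_add_left: "lie_eq (LScale (c + d) x) (LAdd (LScale c x) (LScale d x))"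
| scale_scale: "lie_eq (LScale c (LScale d x)) (LScale (c * d) x)"
| scale_one: "lie_eq (LScale 1 x) x"
| br_add_left: "lie_eq (LBr (LAdd x y) z) (LAdd (LBr x z) (LBr y z))"
| br_add_right: "lie_eq (LBr x (LAdd y z)) (LAdd (LBr x y) (LBr x z))"
| br_scale_left: "lie_eq (LBr (LScale c x) y) (LScale c (LBr x y))"
| br_scale_right: "lie_eq (LBr x (LScale c y)) (LScale c (LBr x y))"
| br_alt: "lie_eq (LBr x x) LZero"
| jacobi: "lie_eq (LAdd (LBr x (LBr y z)) (LAdd (LBr y (LBr z x)) (LBr z (LBr x y)))) LZero"
| rel_plus: "lie_eq (LBr (LGen Hgen) (LGen Xplus)) (LScale 2 (LGen Xplus))"
| rel_minus: "lie_eq (LBr (LGen Hgen) (LGen Xminus)) (LScale (-2) (LGen Xminus))"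

declare [[typedef_overloaded]]

quotient_type 'k sl2F = "'k::field lie_exp" / lie_eq
  by (intro equivpI reflpI sympI transpI) (blast intro: lie_eq.intros)+

lift_definition sl2F_gen :: "sl2_gen \<Rightarrow> 'k::field sl2F" is LGen .
lift_definition sl2F_add :: "'k::field sl2F \<Rightarrow> 'k sl2F \<Rightarrow> 'k sl2F" is LAdd
  by (rule lie_eq.cong_add)
lift_definition sl2F_scale :: "'k::field \<Rightarrow> 'k sl2F \<Rightarrow> 'k sl2F" is LScale
  by (rule lie_eq.cong_scale)
lift_definition sl2F_br :: "'k::field sl2F \<Rightarrow> 'k sl2F \<Rightarrow> 'k sl2F" is LBr
  by (rule lie_eq.cong_br)


section \<open>Its universal enveloping algebra\<close>

datatype (dead 'k::field) env_exp =
    EIn "'k sl2F"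
  | EZero
  | EOne
  | EAdd "'k env_exp" "'k env_exp"
  | EScale 'k "'k env_exp"
  | EMul "'k env_exp" "'k env_exp"

text \<open>
  The least congruence containing the axioms of unital associative algebras and making
  \<open>EIn\<close> a linear map with EIn [x, y] = EIn x EIn y - EIn y EIn x.
\<close>

inductive env_eq :: "'k::field env_exp \<Rightarrow> 'k env_exp \<Rightarrow> bool" where
  refl: "env_eq x x"
| sym: "env_eq x y \<Longrightarrow> env_eq y x"
| trans: "env_eq x y \<Longrightarrow> env_eq y z \<Longrightarrow> env_eq x z"
| cong_add: "env_eq x x' \<Longrightarrow> env_eq y y' \<Longrightarrow> env_eq (EAdd x y) (EAdd x' y')"
| cong_scale: "env_eq x x' \<Longrightarrow> env_eq (EScale c x) (EScale c x')"
| cong_mul: "env_eq x x' \<Longrightarrow> env_eq y y' \<Longrightarrow> env_eq (EMul x y) (EMul x' y')"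
| add_assoc: "env_eq (EAdd (EAdd x y) z) (EAdd x (EAdd y z))"
| add_comm: "env_eq (EAdd x y) (EAdd y x)"
| add_zero: "env_eq (EAdd EZero x) x"
| add_inv: "env_eq (EAdd (EScale (-1) x) x) EZero"
| scale_add_right: "env_eq (EScale c (EAdd x y)) (EAdd (EScale c x) (EScale c y))"
| scale_add_left: "env_eq (EScale (c + d) x) (EAdd (EScale c x) (EScale d x))"
| scale_scale: "env_eq (EScale c (EScale d x)) (EScale (c * d) x)"
| scale_one: "env_eq (EScale 1 x) x"
| mul_assoc: "env_eq (EMul (EMul x y) z) (EMul x (EMul y z))"
| mul_one_left: "env_eq (EMul EOne x) x"
| mul_one_right: "env_eq (EMul x EOne) x"
| mul_add_left: "env_eq (EMul (EAdd x y) z) (EAdd (EMul x z) (EMul y z))"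
| mul_add_right: "env_eq (EMul x (EAdd y z)) (EAdd (EMul x y) (EMul x z))"
| mul_scale_left: "env_eq (EMul (EScale c x) y) (EScale c (EMul x y))"
| mul_scale_right: "env_eq (EMul x (EScale c y)) (EScale c (EMul x y))"
| in_add: "env_eq (EIn (sl2F_add a b)) (EAdd (EIn a) (EIn b))"
| in_scale: "env_eq (EIn (sl2F_scale c a)) (EScale c (EIn a))"
| in_br: "env_eq (EIn (sl2F_br a b))
            (EAdd (EMul (EIn a) (EIn b)) (EScale (-1) (EMul (EIn b) (EIn a))))"

quotient_type 'k Usl2F = "'k::field env_exp" / env_eq
  by (intro equivpI reflpI sympI transpI) (blast intro: env_eq.intros)+


section \<open>The representations\<close>

text \<open>
  A colouring is a pair of functions \<open>(\<psi>\<^sup>-, \<psi>\<^sup>+)\<close> on the pairs (n, k) with \<open>1 \<le> k \<le> n\<close>;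
  here they are total functions, but the values at other pairs are never used.
\<close>

type_synonym 'k colouring = "(nat \<Rightarrow> nat \<Rightarrow> 'k fps) \<times> (nat \<Rightarrow> nat \<Rightarrow> 'k fps)"

definition colour_prod :: "'k::field colouring \<Rightarrow> nat \<Rightarrow> nat \<Rightarrow> 'k fps" where
  "colour_prod \<psi> n k = fst \<psi> n k * snd \<psi> n (n - k + 1)"

text \<open>
  The free module with basis \<open>b\<^sub>0, \<dots>, b\<^sub>n\<close>, as coordinate sequences vanishing beyond n.
\<close>

type_synonym 'k vec = "nat \<Rightarrow> 'k fps"

definition L_carrier :: "nat \<Rightarrow> 'k::field vec set" where
  "L_carrier n = {v. \<forall>p>n. v p = 0}"

definition L_basis :: "nat \<Rightarrow> 'k::field vec" where
  "L_basis p = (\<lambda>q. if q = p then 1 else 0)"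

definition vscale :: "'k::field fps \<Rightarrow> 'k vec \<Rightarrow> 'k vec" where
  "vscale c v = (\<lambda>q. c * v q)"

definition vadd :: "'k::field vec \<Rightarrow> 'k vec \<Rightarrow> 'k vec" where
  "vadd v w = (\<lambda>q. v q + w q)"

definition vzero :: "'k::field vec" where
  "vzero = (\<lambda>q. 0)"

definition lin_ext :: "nat \<Rightarrow> (nat \<Rightarrow> 'k::field vec) \<Rightarrow> 'k vec \<Rightarrow> 'k vec" where
  "lin_ext n f v = (\<lambda>q. \<Sum>p\<le>n. v p * f p q)"

fun gen_act :: "'k::field colouring \<Rightarrow> nat \<Rightarrow> sl2_gen \<Rightarrow> 'k vec \<Rightarrow> 'k vec" where
  "gen_act \<psi> n Hgen =
     lin_ext n (\<lambda>p. vscale (of_int (int n - 2 * int p)) (L_basis p))"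
| "gen_act \<psi> n Xminus =
     lin_ext n (\<lambda>p. if p \<noteq> n then vscale (fst \<psi> n (p + 1)) (L_basis (p + 1)) else vzero)"
| "gen_act \<psi> n Xplus =
     lin_ext n (\<lambda>p. if p \<noteq> 0 then vscale (snd \<psi> n (n - p + 1)) (L_basis (p - 1)) else vzero)"

fun lie_act :: "'k::field colouring \<Rightarrow> nat \<Rightarrow> 'k lie_exp \<Rightarrow> 'k vec \<Rightarrow> 'k vec" where
  "lie_act \<psi> n (LGen g) v = gen_act \<psi> n g v"
| "lie_act \<psi> n LZero v = vzero"
| "lie_act \<psi> n (LAdd x y) v = vadd (lie_act \<psi> n x v) (lie_act \<psi> n y v)"
| "lie_act \<psi> n (LScale c x) v = vscale (fps_const c) (lie_act \<psi> n x v)"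
| "lie_act \<psi> n (LBr x y) v =
     vadd (lie_act \<psi> n x (lie_act \<psi> n y v)) (vscale (-1) (lie_act \<psi> n y (lie_act \<psi> n x v)))"

definition vlinear :: "('k::field vec \<Rightarrow> 'k vec) \<Rightarrow> bool" where
  "vlinear f \<longleftrightarrow> (\<forall>v w. f (vadd v w) = vadd (f v) (f w)) \<and> (\<forall>c v. f (vscale c v) = vscale c (f v))"

lemma vec_apply [simp]:
  "vadd v w q = v q + w q" "vscale c v q = c * v q" "vzero q = 0"
  by (simp_all add: vadd_def vscale_def vzero_def)

lemma vlinearD:
  assumes "vlinear f"
  shows "f (vadd v w) = vadd (f v) (f w)" "f (vscale c v) = vscale c (f v)" "f vzero = vzero"
proof -
  show "f (vadd v w) = vadd (f v) (f w)" and scale: "f (vscale c v) = vscale c (f v)" for c v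
    using assms by (auto simp: vlinear_def)
  have "vscale 0 vzero = (vzero :: 'a vec)" and "vscale 0 (f vzero) = vzero"
    by (simp_all add: fun_eq_iff)
  then show "f vzero = vzero"
    using scale[of 0 vzero] by simp
qed

lemma vlinear_lin_ext: "vlinear (lin_ext n f)"
  unfolding vlinear_def lin_ext_def fun_eq_iff
  by (simp add: algebra_simps sum.distrib sum_distrib_left)

declare gen_act.simps [simp del]

lemma vlinear_gen_act: "vlinear (gen_act \<psi> n g)"
  by (cases g) (simp_all add: vlinear_lin_ext gen_act.simps)

lemma vlinear_lie_act: "vlinear (lie_act \<psi> n x)"
proof (induction x)
  case (LGen g)
  show ?case using vlinear_gen_act[of \<psi> n g] by (simp add: vlinear_def)
next
  case (LBr x y)
  show ?case
    unfolding vlinear_def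
    by (simp add: fun_eq_iff vlinearD[OF LBr.IH(1)] vlinearD[OF LBr.IH(2)] algebra_simps)
qed (auto simp: vlinear_def algebra_simps fun_eq_iff)

lemma lin_ext_basis:
  assumes "p \<le> n"
  shows "lin_ext n f (L_basis p) = f p"
proof
  fix q
  have "lin_ext n f (L_basis p) q = (\<Sum>p'\<le>n. if p' = p then f p q else 0)"
    unfolding lin_ext_def L_basis_def by (intro sum.cong) auto
  then show "lin_ext n f (L_basis p) q = f p q"
    using assms by simp
qed

lemma gen_act_basis:
  assumes "p \<le> n"
  shows "gen_act \<psi> n Hgen (L_basis p) = vscale (of_int (int n - 2 * int p)) (L_basis p)"
    and "gen_act \<psi> n Xminus (L_basis p) =
           (if p \<noteq> n then vscale (fst \<psi> n (p + 1)) (L_basis (p + 1)) else vzero)"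
    and "gen_act \<psi> n Xplus (L_basis p) =
           (if p \<noteq> 0 then vscale (snd \<psi> n (n - p + 1)) (L_basis (p - 1)) else vzero)"
  using assms by (simp_all add: gen_act.simps lin_ext_basis fun_eq_iff)

lemma gen_act_apply:
  "gen_act \<psi> n Hgen v q = (if q \<le> n then of_int (int n - 2 * int q) * v q else 0)"
  "gen_act \<psi> n Xminus v q = (if 1 \<le> q \<and> q \<le> n then fst \<psi> n q * v (q - 1) else 0)"
  "gen_act \<psi> n Xplus v q = (if q + 1 \<le> n then snd \<psi> n (n - q) * v (q + 1) else 0)"
proof -
  have "gen_act \<psi> n Hgen v q =
      (\<Sum>p\<le>n. if p = q then of_int (int n - 2 * int q) * v q else 0)"
    unfolding gen_act.simps lin_ext_def by (intro sum.cong) (auto simp: L_basis_def)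
  then show "gen_act \<psi> n Hgen v q = (if q \<le> n then of_int (int n - 2 * int q) * v q else 0)"
    by simp
  have "gen_act \<psi> n Xminus v q =
      (\<Sum>p\<le>n. if p = q - 1 then (if 1 \<le> q \<and> q \<le> n then fst \<psi> n q * v (q - 1) else 0) else 0)"
    unfolding gen_act.simps lin_ext_def by (intro sum.cong) (auto simp: L_basis_def)
  then show "gen_act \<psi> n Xminus v q = (if 1 \<le> q \<and> q \<le> n then fst \<psi> n q * v (q - 1) else 0)"
    by (auto split: if_splits)
  have "gen_act \<psi> n Xplus v q =
      (\<Sum>p\<le>n. if p = q + 1 then snd \<psi> n (n - q) * v (q + 1) else 0)"
    unfolding gen_act.simps lin_ext_def
    by (intro sum.cong) (auto simp: L_basis_def Suc_diff_Suc)
  then show "gen_act \<psi> n Xplus v q = (if q + 1 \<le> n then snd \<psi> n (n - q) * v (q + 1) else 0)"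
    by simp
qed

lemma lie_act_respects: "lie_eq x y \<Longrightarrow> lie_act \<psi> n x = lie_act \<psi> n y"
proof (induction rule: lie_eq.induct)
  case (cong_br x x' y y')
  show ?case by (intro ext) (simp add: cong_br.IH)
next
  case rel_plus
  show ?case
    by (rule ext, rule ext)
      (auto simp: gen_act_apply algebra_simps simp flip: numeral_fps_const)
next
  case rel_minus
  show ?case
    by (rule ext, rule ext)
      (auto simp: gen_act_apply algebra_simps fps_const_neg[symmetric] of_nat_diff
            simp flip: numeral_fps_const
            simp del: fps_const_neg)
qed (auto simp: fun_eq_iff vlinearD[OF vlinear_lie_act] algebra_simps
        fps_const_add[symmetric] fps_const_mult[symmetric] fps_const_neg[symmetric]
        simp del: fps_const_add fps_const_mult fps_const_neg)


lift_definition sl2F_act :: "'k::field colouring \<Rightarrow> nat \<Rightarrow> 'k sl2F \<Rightarrow> 'k vec \<Rightarrow> 'k vec" is lie_act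
  by (rule lie_act_respects)

lemma vlinear_sl2F_act: "vlinear (sl2F_act \<psi> n a)"
  by transfer (rule vlinear_lie_act)

lemma sl2F_act_simps:
  "sl2F_act \<psi> n (sl2F_gen g) v = gen_act \<psi> n g v"
  "sl2F_act \<psi> n (sl2F_add a b) v = vadd (sl2F_act \<psi> n a v) (sl2F_act \<psi> n b v)"
  "sl2F_act \<psi> n (sl2F_scale c a) v = vscale (fps_const c) (sl2F_act \<psi> n a v)"
  "sl2F_act \<psi> n (sl2F_br a b) v =
     vadd (sl2F_act \<psi> n a (sl2F_act \<psi> n b v)) (vscale (-1) (sl2F_act \<psi> n b (sl2F_act \<psi> n a v)))"
  by (transfer, simp)+

fun env_act :: "'k::field colouring \<Rightarrow> nat \<Rightarrow> 'k env_exp \<Rightarrow> 'k vec \<Rightarrow> 'k vec" where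
  "env_act \<psi> n (EIn a) v = sl2F_act \<psi> n a v"
| "env_act \<psi> n EZero v = vzero"
| "env_act \<psi> n EOne v = v"
| "env_act \<psi> n (EAdd x y) v = vadd (env_act \<psi> n x v) (env_act \<psi> n y v)"
| "env_act \<psi> n (EScale c x) v = vscale (fps_const c) (env_act \<psi> n x v)"
| "env_act \<psi> n (EMul x y) v = env_act \<psi> n x (env_act \<psi> n y v)"

lemma vlinear_env_act: "vlinear (env_act \<psi> n x)"
proof (induction x)
  case (EIn a)
  show ?case using vlinear_sl2F_act[of \<psi> n a] by (simp add: vlinear_def)
next
  case (EMul x y)
  show ?case
    unfolding vlinear_def by (simp add: vlinearD[OF EMul.IH(1)] vlinearD[OF EMul.IH(2)])
qed (auto simp: vlinear_def algebra_simps fun_eq_iff)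

lemma env_act_respects: "env_eq x y \<Longrightarrow> env_act \<psi> n x = env_act \<psi> n y"
proof (induction rule: env_eq.induct)
  case (cong_mul x x' y y')
  show ?case by (intro ext) (simp add: cong_mul.IH)
qed (auto simp: fun_eq_iff vlinearD[OF vlinear_env_act] sl2F_act_simps algebra_simps
        fps_const_add[symmetric] fps_const_mult[symmetric] fps_const_neg[symmetric]
        simp del: fps_const_add fps_const_mult fps_const_neg)

lift_definition Usl2F_act :: "'k::field colouring \<Rightarrow> nat \<Rightarrow> 'k Usl2F \<Rightarrow> 'k vec \<Rightarrow> 'k vec" is env_act
  by (rule env_act_respects)

instantiation Usl2F :: (field) ring_1
begin

lift_definition zero_Usl2F :: "'a Usl2F" is EZero .
lift_definition one_Usl2F :: "'a Usl2F" is EOne .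
lift_definition plus_Usl2F :: "'a Usl2F \<Rightarrow> 'a Usl2F \<Rightarrow> 'a Usl2F" is EAdd
  by (rule env_eq.cong_add)
lift_definition times_Usl2F :: "'a Usl2F \<Rightarrow> 'a Usl2F \<Rightarrow> 'a Usl2F" is EMul
  by (rule env_eq.cong_mul)
lift_definition uminus_Usl2F :: "'a Usl2F \<Rightarrow> 'a Usl2F" is "EScale (-1)"
  by (rule env_eq.cong_scale)
definition minus_Usl2F :: "'a Usl2F \<Rightarrow> 'a Usl2F \<Rightarrow> 'a Usl2F" where
  "minus_Usl2F x y = x + - y"

instance
proof
  fix x y z :: "'a Usl2F"
  show "x + y + z = x + (y + z)" by transfer (rule env_eq.add_assoc)
  show "x + y = y + x" by transfer (rule env_eq.add_comm)
  show "0 + x = x" by transfer (rule env_eq.add_zero)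
  show "- x + x = 0" by transfer (rule env_eq.add_inv)
  show "x - y = x + - y" by (rule minus_Usl2F_def)
  show "x * y * z = x * (y * z)" by transfer (rule env_eq.mul_assoc)
  show "1 * x = x" by transfer (rule env_eq.mul_one_left)
  show "x * 1 = x" by transfer (rule env_eq.mul_one_right)
  show "(x + y) * z = x * z + y * z" by transfer (rule env_eq.mul_add_left)
  show "x * (y + z) = x * y + x * z" by transfer (rule env_eq.mul_add_right)
  define \<psi> :: "'a colouring" where "\<psi> = ((\<lambda>_ _. 0), (\<lambda>_ _. 0))"
  have "Usl2F_act \<psi> 0 0 (L_basis 0) = vzero" "Usl2F_act \<psi> 0 1 (L_basis 0) = L_basis 0"
    by (simp_all add: zero_Usl2F_def one_Usl2F_def Usl2F_act.abs_eq fun_eq_iff)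
  moreover have "vzero 0 \<noteq> (L_basis 0 :: 'a vec) 0"
    by (simp add: L_basis_def)
  ultimately have "Usl2F_act \<psi> 0 0 \<noteq> Usl2F_act \<psi> 0 1"
    by metis
  then show "(0::'a Usl2F) \<noteq> 1" by metis
qed

end

lift_definition Usl2F_scale :: "'k::field \<Rightarrow> 'k Usl2F \<Rightarrow> 'k Usl2F" is EScale
  by (rule env_eq.cong_scale)

lift_definition Usl2F_in :: "'k::field sl2F \<Rightarrow> 'k Usl2F" is EIn .

lemma Usl2F_act_simps:
  "Usl2F_act \<psi> n 0 v = vzero"
  "Usl2F_act \<psi> n 1 v = v"
  "Usl2F_act \<psi> n (x + y) v = vadd (Usl2F_act \<psi> n x v) (Usl2F_act \<psi> n y v)"
  "Usl2F_act \<psi> n (x * y) v = Usl2F_act \<psi> n x (Usl2F_act \<psi> n y v)"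
  "Usl2F_act \<psi> n (Usl2F_scale c x) v = vscale (fps_const c) (Usl2F_act \<psi> n x v)"
  "Usl2F_act \<psi> n (Usl2F_in a) v = sl2F_act \<psi> n a v"
  by (simp_all add: zero_Usl2F_def one_Usl2F_def Usl2F_in_def Usl2F_act.abs_eq)
    (transfer, simp)+

lemma L_carrier_gen_act: "gen_act \<psi> n g v \<in> L_carrier n"
  by (cases g) (auto simp: L_carrier_def gen_act_apply)

lemma L_carrier_closed:
  "vzero \<in> L_carrier n"
  "v \<in> L_carrier n \<Longrightarrow> w \<in> L_carrier n \<Longrightarrow> vadd v w \<in> L_carrier n"
  "v \<in> L_carrier n \<Longrightarrow> vscale c v \<in> L_carrier n"
  by (auto simp: L_carrier_def)

lemma L_carrier_sl2F_act: "v \<in> L_carrier n \<Longrightarrow> sl2F_act \<psi> n a v \<in> L_carrier n"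
proof (transfer fixing: \<psi> n v)
  fix x :: "'a lie_exp"
  assume "v \<in> L_carrier n"
  then show "lie_act \<psi> n x v \<in> L_carrier n"
    by (induction x arbitrary: v) (auto simp: L_carrier_gen_act L_carrier_closed)
qed

lemma L_carrier_Usl2F_act: "v \<in> L_carrier n \<Longrightarrow> Usl2F_act \<psi> n a v \<in> L_carrier n"
proof (transfer fixing: \<psi> n v)
  fix x :: "'a env_exp"
  assume "v \<in> L_carrier n"
  then show "env_act \<psi> n x v \<in> L_carrier n"
    by (induction x arbitrary: v) (auto simp: L_carrier_sl2F_act L_carrier_closed)
qed

lemma vlinear_Usl2F_act: "vlinear (Usl2F_act \<psi> n x)"
  by transfer (rule vlinear_env_act)


section \<open>The algebra of formal power series over it, and its quotient\<close>

text \<open>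
  The product of type \<open>'k Usl2F fps\<close> is the Cauchy product, in which \<open>fps_X\<close> (the
  parameter h) is central.
\<close>

definition UhF_gen :: "sl2_gen \<Rightarrow> 'k::field Usl2F fps" where
  "UhF_gen g = fps_const (Usl2F_in (sl2F_gen g))"

definition Usl2F_poly :: "'k::field poly \<Rightarrow> 'k Usl2F \<Rightarrow> 'k Usl2F" where
  "Usl2F_poly P x = (\<Sum>i\<le>degree P. Usl2F_scale (coeff P i) (x ^ i))"

definition UhF_of_H :: "'k::field poly fps \<Rightarrow> 'k Usl2F fps" where
  "UhF_of_H P = Abs_fps (\<lambda>m. Usl2F_poly (fps_nth P m) (Usl2F_in (sl2F_gen Hgen)))"

text \<open>
  The action of \<open>x = \<Sum>m. x\<^sub>m h\<^sup>m\<close> is \<open>x.v = \<Sum>m. h\<^sup>m (x\<^sub>m.v)\<close>, an h-adically convergent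
  sum, written out on the coefficients of the coordinates.
\<close>

definition UhF_act :: "'k::field colouring \<Rightarrow> nat \<Rightarrow> 'k Usl2F fps \<Rightarrow> 'k vec \<Rightarrow> 'k vec" where
  "UhF_act \<psi> n x v =
     (\<lambda>q. Abs_fps (\<lambda>N. \<Sum>m\<le>N. fps_nth (Usl2F_act \<psi> n (fps_nth x m) v q) (N - m)))"

lemma UhF_act_nth:
  "fps_nth (UhF_act \<psi> n x v q) N =
     (\<Sum>m\<le>N. fps_nth (Usl2F_act \<psi> n (fps_nth x m) v q) (N - m))"
  by (simp add: UhF_act_def)

lemma UhF_act_simps:
  "UhF_act \<psi> n 0 v = vzero"
  "UhF_act \<psi> n 1 v = v"
  "UhF_act \<psi> n (x + y) v = vadd (UhF_act \<psi> n x v) (UhF_act \<psi> n y v)"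
  "UhF_act \<psi> n (fps_const a) v = Usl2F_act \<psi> n a v"
  "UhF_act \<psi> n (UhF_gen g) v = gen_act \<psi> n g v"
  "UhF_act \<psi> n fps_X v = vscale fps_X v"
proof -
  show const: "UhF_act \<psi> n (fps_const a) v = Usl2F_act \<psi> n a v" for a
  proof (intro ext fps_ext)
    fix q N
    have "fps_nth (UhF_act \<psi> n (fps_const a) v q) N =
        (\<Sum>m\<le>N. if m = 0 then fps_nth (Usl2F_act \<psi> n a v q) N else 0)"
      unfolding UhF_act_nth by (intro sum.cong) (auto simp: Usl2F_act_simps)
    then show "fps_nth (UhF_act \<psi> n (fps_const a) v q) N = fps_nth (Usl2F_act \<psi> n a v q) N"
      by simp
  qed
  show "UhF_act \<psi> n (UhF_gen g) v = gen_act \<psi> n g v"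
    by (simp add: UhF_gen_def const Usl2F_act_simps sl2F_act_simps)
  show "UhF_act \<psi> n 0 v = vzero" "UhF_act \<psi> n 1 v = v"
    using const[of 0] const[of 1] by (simp_all add: Usl2F_act_simps)
  show "UhF_act \<psi> n (x + y) v = vadd (UhF_act \<psi> n x v) (UhF_act \<psi> n y v)"
    by (intro ext fps_ext) (simp add: UhF_act_nth Usl2F_act_simps sum.distrib)
  show "UhF_act \<psi> n fps_X v = vscale fps_X v"
  proof (intro ext fps_ext)
    fix q N
    have "fps_nth (UhF_act \<psi> n fps_X v q) N =
        (\<Sum>m\<le>N. if m = 1 then fps_nth (v q) (N - 1) else 0)"
      unfolding UhF_act_nth by (intro sum.cong) (auto simp: Usl2F_act_simps fps_X_def)
    then show "fps_nth (UhF_act \<psi> n fps_X v q) N = fps_nth (vscale fps_X v q) N"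
      by simp
  qed
qed

lemma vlinear_cong_nth:
  assumes f: "vlinear f" and eq: "\<And>q i. i \<le> K \<Longrightarrow> fps_nth (u q) i = fps_nth (w q) i"
    and "i \<le> K"
  shows "fps_nth (f u q) i = fps_nth (f w q) i"
proof -
  define d where "d = (\<lambda>q. fps_shift (Suc K) (u q - w q))"
  have "u = vadd w (vscale (fps_X ^ Suc K) d)"
  proof (intro ext fps_ext)
    show "fps_nth (u q) i = fps_nth (vadd w (vscale (fps_X ^ Suc K) d) q) i" for q i
      using eq[of i q] by (auto simp: d_def fps_X_power_mult_nth simp del: power_Suc)
  qed
  then have "f u = vadd (f w) (vscale (fps_X ^ Suc K) (f d))"
    using f by (metis vlinearD(1,2))
  then show ?thesis
    using \<open>i \<le> K\<close> by (simp add: fps_X_power_mult_nth del: power_Suc)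
qed

lemma vlinear_sum:
  assumes "vlinear f" and "finite A"
  shows "f (\<lambda>q. \<Sum>i\<in>A. g i q) = (\<lambda>q. \<Sum>i\<in>A. f (g i) q)"
  using assms(2)
proof (induction rule: finite_induct)
  case empty
  show ?case using vlinearD(3)[OF assms(1)] by (simp add: vzero_def)
next
  case (insert a A)
  then show ?case
    using vlinearD(1)[OF assms(1), of "g a" "\<lambda>q. \<Sum>i\<in>A. g i q"] by (simp add: vadd_def)
qed

lemma vlinear_UhF_act: "vlinear (UhF_act \<psi> n x)"
  unfolding vlinear_def
proof (intro conjI allI ext fps_ext)
  fix v w :: "'a vec" and q N
  show "fps_nth (UhF_act \<psi> n x (vadd v w) q) N =
      fps_nth (vadd (UhF_act \<psi> n x v) (UhF_act \<psi> n x w) q) N"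
    by (simp add: UhF_act_nth vlinearD[OF vlinear_Usl2F_act] sum.distrib)
next
  fix c and v :: "'a vec" and q N
  let ?g = "\<lambda>m j. fps_nth (Usl2F_act \<psi> n (fps_nth x m) v q) j"
  have "fps_nth (UhF_act \<psi> n x (vscale c v) q) N =
      (\<Sum>m\<le>N. \<Sum>i\<le>N-m. fps_nth c i * ?g m (N - m - i))"
    by (simp add: UhF_act_nth vlinearD[OF vlinear_Usl2F_act] fps_mult_nth atLeast0AtMost)
  also have "\<dots> = (\<Sum>(m, i)\<in>(SIGMA m:{..N}. {..N-m}). fps_nth c i * ?g m (N - m - i))"
    by (simp add: sum.Sigma)
  also have "\<dots> = (\<Sum>(i, m)\<in>(SIGMA i:{..N}. {..N-i}). fps_nth c i * ?g m (N - i - m))"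
    by (rule sum.reindex_bij_witness[of _ prod.swap prod.swap]) (auto simp: diff_commute add.commute)
  also have "\<dots> = (\<Sum>i\<le>N. fps_nth c i * (\<Sum>m\<le>N-i. ?g m (N - i - m)))"
    by (simp add: sum.Sigma sum_distrib_left)
  also have "\<dots> = fps_nth (vscale c (UhF_act \<psi> n x v) q) N"
    by (simp add: UhF_act_nth fps_mult_nth atLeast0AtMost)
  finally show "fps_nth (UhF_act \<psi> n x (vscale c v) q) N =
      fps_nth (vscale c (UhF_act \<psi> n x v) q) N" .
qed

lemma Usl2F_act_sum:
  "finite A \<Longrightarrow> Usl2F_act \<psi> n (\<Sum>i\<in>A. g i) v = (\<lambda>q. \<Sum>i\<in>A. Usl2F_act \<psi> n (g i) v q)"
  by (induction rule: finite_induct) (auto simp: Usl2F_act_simps vzero_def vadd_def)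

lemma UhF_act_mult: "UhF_act \<psi> n (x * y) v = UhF_act \<psi> n x (UhF_act \<psi> n y v)"
proof (intro ext fps_ext)
  fix q N
  let ?T = "\<lambda>m. Usl2F_act \<psi> n (fps_nth x m)" and ?S = "\<lambda>l. Usl2F_act \<psi> n (fps_nth y l) v"
  have T: "fps_nth (?T m (UhF_act \<psi> n y v) q) K =
      (\<Sum>l\<le>K. fps_nth (?T m (?S l) q) (K - l))" for m K
  proof -
    define w where "w = (\<lambda>q. \<Sum>l\<le>K. vscale (fps_X ^ l) (?S l) q)"
    have "fps_nth (UhF_act \<psi> n y v r) i = fps_nth (w r) i" if "i \<le> K" for r i
    proof -
      have "fps_nth (w r) i = (\<Sum>l\<le>K. if l \<le> i then fps_nth (?S l r) (i - l) else 0)"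
        by (auto simp: w_def fps_sum_nth fps_X_power_mult_nth intro!: sum.cong)
      also have "\<dots> = (\<Sum>l\<le>i. fps_nth (?S l r) (i - l))"
        using that by (intro sum.mono_neutral_cong_right) auto
      finally show ?thesis by (simp add: UhF_act_nth)
    qed
    then have "fps_nth (?T m (UhF_act \<psi> n y v) q) K = fps_nth (?T m w q) K"
      by (rule vlinear_cong_nth[OF vlinear_Usl2F_act _ order.refl])
    also have "?T m w = (\<lambda>q. \<Sum>l\<le>K. vscale (fps_X ^ l) (?T m (?S l)) q)"
      unfolding w_def
      by (subst vlinear_sum[OF vlinear_Usl2F_act]) (simp_all add: vlinearD[OF vlinear_Usl2F_act])
    also have "fps_nth (\<Sum>l\<le>K. vscale (fps_X ^ l) (?T m (?S l)) q) K =
        (\<Sum>l\<le>K. fps_nth (?T m (?S l) q) (K - l))"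
      by (auto simp: fps_sum_nth fps_X_power_mult_nth intro!: sum.cong)
    finally show ?thesis .
  qed
  have "fps_nth (UhF_act \<psi> n (x * y) v q) N =
      (\<Sum>M\<le>N. \<Sum>i\<le>M. fps_nth (?T i (?S (M - i)) q) (N - M))"
    by (simp add: UhF_act_nth fps_mult_nth Usl2F_act_sum Usl2F_act_simps fps_sum_nth atLeast0AtMost)
  also have "\<dots> = (\<Sum>(M, i)\<in>(SIGMA M:{..N}. {..M}). fps_nth (?T i (?S (M - i)) q) (N - M))"
    by (simp add: sum.Sigma)
  also have "\<dots> = (\<Sum>(m, l)\<in>(SIGMA m:{..N}. {..N-m}). fps_nth (?T m (?S l) q) (N - m - l))"
    by (rule sum.reindex_bij_witness[of _ "\<lambda>(m, l). (m + l, m)" "\<lambda>(M, i). (i, M - i)"]) auto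
  also have "\<dots> = (\<Sum>m\<le>N. \<Sum>l\<le>N-m. fps_nth (?T m (?S l) q) (N - m - l))"
    by (simp add: sum.Sigma)
  also have "\<dots> = fps_nth (UhF_act \<psi> n x (UhF_act \<psi> n y v) q) N"
    by (simp add: UhF_act_nth[of \<psi> n x] T)
  finally show "fps_nth (UhF_act \<psi> n (x * y) v q) N =
      fps_nth (UhF_act \<psi> n x (UhF_act \<psi> n y v) q) N" .
qed

lemma L_carrier_UhF_act: "v \<in> L_carrier n \<Longrightarrow> UhF_act \<psi> n x v \<in> L_carrier n"
  using L_carrier_Usl2F_act[of v n \<psi>] by (auto simp: L_carrier_def UhF_act_def fps_eq_iff)

definition UhF_annihilator :: "'k::field colouring \<Rightarrow> 'k Usl2F fps set" where
  "UhF_annihilator \<psi> = {x. \<forall>n. \<forall>v\<in>L_carrier n. UhF_act \<psi> n x v = vzero}"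

lemma ring_ring_of_type_algebra: "ring (ring_of_type_algebra :: 'a::ring_1 ring)"
proof -
  have "\<exists>y. x + y = 0" for x :: 'a
    using add.right_inverse by blast
  then show ?thesis
    unfolding ring_of_type_algebra_def using add.right_inverse
    by unfold_locales (auto simp: algebra_simps Units_def)
qed

lemma ideal_UhF_annihilator: "ideal (UhF_annihilator \<psi>) ring_of_type_algebra"
proof (rule idealI)
  show "ring (ring_of_type_algebra :: 'a Usl2F fps ring)"
    by (rule ring_ring_of_type_algebra)
  interpret ring "ring_of_type_algebra :: 'a Usl2F fps ring"
    by (rule ring_ring_of_type_algebra)
  have minus: "UhF_act \<psi> n (- x) v = vzero" if "UhF_act \<psi> n x v = vzero" for n x v
    using UhF_act_simps(3)[of \<psi> n x "- x" v] that
    by (simp add: UhF_act_simps(1) fun_eq_iff)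
  have inv: "\<ominus>\<^bsub>ring_of_type_algebra\<^esub> x = - x" for x :: "'a Usl2F fps"
    by (rule minus_equality) (auto simp: ring_of_type_algebra_def)
  show "subgroup (UhF_annihilator \<psi>) (add_monoid ring_of_type_algebra)"
    by (rule add.subgroupI)
      (auto simp: UhF_annihilator_def UhF_act_simps minus inv[unfolded ring_of_type_algebra_def]
         ring_of_type_algebra_def fun_eq_iff intro!: exI[of _ 0])
  fix a x :: "'a Usl2F fps"
  assume "a \<in> UhF_annihilator \<psi>"
  then show "x \<otimes>\<^bsub>ring_of_type_algebra\<^esub> a \<in> UhF_annihilator \<psi>"
    and "a \<otimes>\<^bsub>ring_of_type_algebra\<^esub> x \<in> UhF_annihilator \<psi>"
    using vlinearD(3)[OF vlinear_UhF_act[of \<psi>]]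
    by (auto simp: UhF_annihilator_def ring_of_type_algebra_def UhF_act_mult L_carrier_UhF_act)
qed

definition Uh :: "'k::field colouring \<Rightarrow> 'k Usl2F fps set ring" where
  "Uh \<psi> = ring_of_type_algebra Quot UhF_annihilator \<psi>"

definition Uh_class :: "'k::field colouring \<Rightarrow> 'k Usl2F fps \<Rightarrow> 'k Usl2F fps set" where
  "Uh_class \<psi> x = UhF_annihilator \<psi> +>\<^bsub>ring_of_type_algebra\<^esub> x"

text \<open>
  The series with terms \<open>f a\<close> in the quotient converges h-adically to \<open>y\<close>: modulo each
  \<open>h\<^sup>N\<close>, the partial sums are eventually equal to \<open>y\<close>.
\<close>

definition Uh_sums ::
    "'k::field colouring \<Rightarrow> (nat \<Rightarrow> 'k Usl2F fps set) \<Rightarrow> 'k Usl2F fps set \<Rightarrow> bool" where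
  "Uh_sums \<psi> f y \<longleftrightarrow>
     (\<forall>N. \<exists>A. \<forall>B\<ge>A. \<exists>z\<in>carrier (Uh \<psi>).
        y = (\<Oplus>\<^bsub>Uh \<psi>\<^esub>a\<in>{..<B}. f a) \<oplus>\<^bsub>Uh \<psi>\<^esub> (Uh_class \<psi> (fps_X ^ N) \<otimes>\<^bsub>Uh \<psi>\<^esub> z))"


section \<open>The equation\<close>

definition fps_poly_eval :: "'k::field poly fps \<Rightarrow> int \<Rightarrow> 'k fps" where
  "fps_poly_eval P z = Abs_fps (\<lambda>m. poly (fps_nth P m) (of_int z))"

text \<open>
  Convergence is with respect to the metric topology of type \<open>fps\<close>, which is the h-adic one.
\<close>

definition GQE_solution :: "'k::field colouring \<Rightarrow> (nat \<Rightarrow> 'k poly fps) \<Rightarrow> bool" where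
  "GQE_solution \<psi> M \<longleftrightarrow>
     M \<longlonglongrightarrow> 0 \<and>
     (\<forall>n p. p \<le> n \<longrightarrow>
        (\<Sum>a\<le>p. (\<Prod>k=p-a+1..p. colour_prod \<psi> n k) *
                fps_poly_eval (M a) (int n - 2 * int p + 2 * int a)) =
        (if p + 1 \<le> n then colour_prod \<psi> n (p + 1) else 0))"

end

theory Submission
  imports Defs
begin

text \<open>
  For \<open>a \<le> p\<close> the operator \<open>(X\<^sup>-)\<^sup>a M\<^sub>a(H) (X\<^sup>+)\<^sup>a\<close> multiplies the basis vector \<open>b\<^sub>p\<close> of \<open>L\<^sub>h(n, \<psi>)\<close>
  by the a-th summand of the equation at \<open>(n, p)\<close>, and for \<open>a > p\<close> it kills \<open>b\<^sub>p\<close>; likewise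
  \<open>X\<^sup>+X\<^sup>-\<close> multiplies \<open>b\<^sub>p\<close> by the right-hand side.  So once \<open>B > p\<close>, the difference between \<open>X\<^sup>+X\<^sup>-\<close>
  and the B-th partial sum acts on \<open>b\<^sub>p\<close> by the defect of the equation at \<open>(n, p)\<close>.
  Convergence in the quotient makes this defect divisible by every power of h, hence zero.
  Conversely, since \<open>M\<close> tends to 0, the differences stabilise coefficientwise to an element of
  \<open>U(sl\<^sub>2\<^sub>,\<^sub>F)[[h]]\<close>, which annihilates every \<open>b\<^sub>p\<close> when all defects vanish.
\<close>

section \<open>Linearity and h-adic locality of the action of power series\<close>

lemma vscale_simps:
  "vscale 1 v = v"
  "vscale c (vscale d v) = vscale (c * d) v"
  "vscale c vzero = vzero"
  by (simp_all add: fun_eq_iff mult.assoc)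

lemma UhF_act_diff:
  "UhF_act \<psi> n (x - y) v q = UhF_act \<psi> n x v q - UhF_act \<psi> n y v q"
  using UhF_act_simps(3)[of \<psi> n "x - y" y v] by (simp add: fun_eq_iff)

lemma UhF_act_sum:
  "UhF_act \<psi> n (\<Sum>a\<in>A. f a) v q = (\<Sum>a\<in>A. UhF_act \<psi> n (f a) v q)"
  by (induction A rule: infinite_finite_induct) (simp_all add: UhF_act_simps)

lemma UhF_act_fps_X_power: "UhF_act \<psi> n (fps_X ^ N) v = vscale (fps_X ^ N) v"
  by (induction N) (simp_all add: UhF_act_simps UhF_act_mult fun_eq_iff mult.assoc)

text \<open>Coefficients of x beyond N reach only higher powers of h. This lets the action of an
  h-adic limit be computed at a finite stage.\<close>

lemma UhF_act_cong_nth: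
  assumes "\<And>m. m \<le> N \<Longrightarrow> fps_nth x m = fps_nth y m"
  shows "fps_nth (UhF_act \<psi> n x v q) N = fps_nth (UhF_act \<psi> n y v q) N"
  using assms by (simp add: UhF_act_nth)

lemma L_carrier_eq_sum:
  assumes "v \<in> L_carrier n"
  shows "v = (\<lambda>q. \<Sum>p\<le>n. vscale (v p) (L_basis p) q)"
proof
  fix q
  have "(\<Sum>p\<le>n. vscale (v p) (L_basis p) q) = (\<Sum>p\<le>n. if p = q then v q else 0)"
    by (intro sum.cong) (auto simp: L_basis_def)
  then show "v q = (\<Sum>p\<le>n. vscale (v p) (L_basis p) q)"
    using assms by (auto simp: L_carrier_def)
qed

text \<open>The action is linear over power series in h, and each vector of
  \<open>L_carrier n\<close> is a finite combination of basis vectors.\<close>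

lemma UhF_annihilator_iff_basis:
  "x \<in> UhF_annihilator \<psi> \<longleftrightarrow> (\<forall>n p. p \<le> n \<longrightarrow> UhF_act \<psi> n x (L_basis p) = vzero)"
proof (intro iffI allI impI)
  fix n p :: nat
  assume "x \<in> UhF_annihilator \<psi>" "p \<le> n"
  moreover have "L_basis p \<in> L_carrier n"
    using \<open>p \<le> n\<close> by (auto simp: L_carrier_def L_basis_def)
  ultimately show "UhF_act \<psi> n x (L_basis p) = vzero"
    by (auto simp: UhF_annihilator_def)
next
  assume basis: "\<forall>n p. p \<le> n \<longrightarrow> UhF_act \<psi> n x (L_basis p) = vzero"
  have "UhF_act \<psi> n x v = vzero" if "v \<in> L_carrier n" for n v
  proof -
    have "UhF_act \<psi> n x v = UhF_act \<psi> n x (\<lambda>q. \<Sum>p\<le>n. vscale (v p) (L_basis p) q)"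
      using L_carrier_eq_sum[OF that] by simp
    also have "\<dots> = vzero"
      by (subst vlinear_sum[OF vlinear_UhF_act])
        (auto simp: vlinearD[OF vlinear_UhF_act] basis fun_eq_iff)
    finally show ?thesis .
  qed
  then show "x \<in> UhF_annihilator \<psi>"
    by (simp add: UhF_annihilator_def)
qed

section \<open>Powers of the generators and series in H on basis vectors\<close>

lemma UhF_act_Xplus_power:
  assumes "p \<le> n"
  shows "UhF_act \<psi> n (UhF_gen Xplus ^ a) (L_basis p) =
    (if a \<le> p then vscale (\<Prod>k=p-a+1..p. snd \<psi> n (n - k + 1)) (L_basis (p - a)) else vzero)"
  using assms
\<comment> \<open>The factor next to the vector is split off; it contributes the index
  \<open>k = p\<close>, and the induction hypothesis applies at \<open>p - 1\<close>.\<close>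
proof (induction a arbitrary: p)
  case 0
  then show ?case by (simp add: UhF_act_simps fun_eq_iff)
next
  case (Suc a)
  show ?case
  proof (cases p)
    case 0
    then show ?thesis
      by (simp add: power_Suc2 UhF_act_mult UhF_act_simps gen_act_basis
            vlinearD[OF vlinear_UhF_act] del: power_Suc)
  next
    case p: (Suc r)
    then show ?thesis
      using Suc.prems
      by (auto simp: power_Suc2 UhF_act_mult UhF_act_simps gen_act_basis Suc.IH
            vlinearD[OF vlinear_UhF_act] vscale_simps mult_ac simp del: power_Suc vec_apply)
  qed
qed

lemma UhF_act_Xminus_power:
  assumes "p + a \<le> n"
  shows "UhF_act \<psi> n (UhF_gen Xminus ^ a) (L_basis p) =
    vscale (\<Prod>k=p+1..p+a. fst \<psi> n k) (L_basis (p + a))"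
  using assms
proof (induction a)
  case 0
  then show ?case by (simp add: UhF_act_simps fun_eq_iff)
next
  case (Suc a)
  then show ?case
    by (simp add: UhF_act_mult UhF_act_simps gen_act_basis vlinearD[OF vlinear_gen_act]
          vscale_simps mult_ac del: vec_apply)
qed

lemma Usl2F_act_Hgen_power:
  assumes "p \<le> n"
  shows "Usl2F_act \<psi> n (Usl2F_in (sl2F_gen Hgen) ^ i) (L_basis p) =
    vscale (fps_const (of_int (int n - 2 * int p) ^ i)) (L_basis p)"
proof (induction i)
  case 0
  then show ?case by (simp add: Usl2F_act_simps fun_eq_iff)
next
  case (Suc i)
  then show ?case
    using assms
    by (simp add: Usl2F_act_simps sl2F_act_simps gen_act_basis vlinearD[OF vlinear_gen_act]
          vscale_simps mult_ac del: vec_apply of_int_diff of_int_mult flip: fps_of_int)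
qed

lemma Usl2F_act_poly_Hgen:
  assumes "p \<le> n"
  shows "Usl2F_act \<psi> n (Usl2F_poly P (Usl2F_in (sl2F_gen Hgen))) (L_basis p) =
    vscale (fps_const (poly P (of_int (int n - 2 * int p)))) (L_basis p)"
proof
  fix q
  show "Usl2F_act \<psi> n (Usl2F_poly P (Usl2F_in (sl2F_gen Hgen))) (L_basis p) q =
      vscale (fps_const (poly P (of_int (int n - 2 * int p)))) (L_basis p) q"
    using assms
    by (simp add: Usl2F_poly_def Usl2F_act_sum Usl2F_act_simps Usl2F_act_Hgen_power poly_altdef
          fps_eq_iff fps_sum_nth sum_distrib_right mult.assoc)
qed

lemma UhF_act_of_H:
  assumes "p \<le> n"
  shows "UhF_act \<psi> n (UhF_of_H P) (L_basis p) =
    vscale (fps_poly_eval P (int n - 2 * int p)) (L_basis p)"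
proof (intro ext fps_ext)
  fix q N
  let ?c = "\<lambda>m. poly (fps_nth P m) (of_int (int n - 2 * int p))"
  \<comment> \<open>Each coefficient of the series in H maps \<open>L_basis p\<close> to a vector
    constant in h, so only \<open>m = N\<close> contributes.\<close>
  have "fps_nth (UhF_act \<psi> n (UhF_of_H P) (L_basis p) q) N =
      (\<Sum>m\<le>N. if m = N then (if q = p then ?c m else 0) else 0)"
    unfolding UhF_act_nth UhF_of_H_def
    by (intro sum.cong) (auto simp: Usl2F_act_poly_Hgen[OF assms], auto simp: L_basis_def)
  then show "fps_nth (UhF_act \<psi> n (UhF_of_H P) (L_basis p) q) N =
      fps_nth (vscale (fps_poly_eval P (int n - 2 * int p)) (L_basis p) q) N"
    by (simp add: fps_poly_eval_def L_basis_def)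
qed

section \<open>Terms of the series, remainders and defects\<close>

lemma Usl2F_scale_zero: "Usl2F_scale 0 x = 0"
proof -
  have "Usl2F_scale (0 + 0) x = Usl2F_scale 0 x + Usl2F_scale 0 x"
    by transfer (rule env_eq.scale_add_left)
  then show ?thesis by simp
qed

definition GQE_term :: "(nat \<Rightarrow> 'k::field poly fps) \<Rightarrow> nat \<Rightarrow> 'k Usl2F fps" where
  "GQE_term M a = UhF_gen Xminus ^ a * UhF_of_H (M a) * UhF_gen Xplus ^ a"

definition GQE_remainder :: "(nat \<Rightarrow> 'k::field poly fps) \<Rightarrow> nat \<Rightarrow> 'k Usl2F fps" where
  "GQE_remainder M B = UhF_gen Xplus * UhF_gen Xminus - (\<Sum>a<B. GQE_term M a)"

definition GQE_defect ::
    "'k::field colouring \<Rightarrow> (nat \<Rightarrow> 'k poly fps) \<Rightarrow> nat \<Rightarrow> nat \<Rightarrow> 'k fps" where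
  "GQE_defect \<psi> M n p =
     (if p + 1 \<le> n then colour_prod \<psi> n (p + 1) else 0) -
     (\<Sum>a\<le>p. (\<Prod>k=p-a+1..p. colour_prod \<psi> n k) *
             fps_poly_eval (M a) (int n - 2 * int p + 2 * int a))"

lemma GQE_solution_iff_defect:
  assumes "M \<longlonglongrightarrow> 0"
  shows "GQE_solution \<psi> M \<longleftrightarrow> (\<forall>n p. p \<le> n \<longrightarrow> GQE_defect \<psi> M n p = 0)"
  unfolding GQE_solution_def GQE_defect_def right_minus_eq
  using assms by (simp add: eq_commute)

text \<open>The outer factors are constant in h, so the h-adic decay of \<open>M\<close> passes to
  the terms.\<close>

lemma GQE_term_nth_eq_0:
  assumes "fps_nth (M a) m = 0"
  shows "fps_nth (GQE_term M a) m = 0"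
  using assms
  by (simp add: GQE_term_def UhF_gen_def UhF_of_H_def Usl2F_poly_def Usl2F_scale_zero)

text \<open>The power of \<open>Xplus\<close> leads to index \<open>p - a\<close>, of weight
  \<open>n - 2 * p + 2 * a\<close>, and that of \<open>Xminus\<close> leads back; both products run
  over the same k and pair up into \<open>colour_prod\<close>.\<close>

lemma UhF_act_GQE_term:
  assumes "p \<le> n"
  shows "UhF_act \<psi> n (GQE_term M a) (L_basis p) =
    (if a \<le> p then vscale ((\<Prod>k=p-a+1..p. colour_prod \<psi> n k) *
                fps_poly_eval (M a) (int n - 2 * int p + 2 * int a)) (L_basis p) else vzero)"
  using assms
  by (auto simp: GQE_term_def UhF_act_mult UhF_act_Xplus_power UhF_act_of_H UhF_act_Xminus_power
        vlinearD[OF vlinear_UhF_act] colour_prod_def prod.distrib fun_eq_iff of_nat_diff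
        algebra_simps)

lemma UhF_act_GQE_remainder:
  assumes "p \<le> n" "p < B"
  shows "UhF_act \<psi> n (GQE_remainder M B) (L_basis p) = vscale (GQE_defect \<psi> M n p) (L_basis p)"
proof
  fix q
  let ?c = "\<lambda>a. (\<Prod>k=p-a+1..p. colour_prod \<psi> n k) *
    fps_poly_eval (M a) (int n - 2 * int p + 2 * int a)"
  have "(\<Sum>a<B. UhF_act \<psi> n (GQE_term M a) (L_basis p) q) =
      (\<Sum>a\<le>p. ?c a * L_basis p q)"
    using assms by (intro sum.mono_neutral_cong_right) (auto simp: UhF_act_GQE_term)
  moreover have "UhF_act \<psi> n (UhF_gen Xplus * UhF_gen Xminus) (L_basis p) q =
      (if p + 1 \<le> n then colour_prod \<psi> n (p + 1) else 0) * L_basis p q"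
    using assms
    by (simp add: UhF_act_mult UhF_act_simps gen_act_basis vlinearD[OF vlinear_gen_act]
          colour_prod_def mult_ac)
  ultimately show "UhF_act \<psi> n (GQE_remainder M B) (L_basis p) q =
      vscale (GQE_defect \<psi> M n p) (L_basis p) q"
    by (simp add: GQE_remainder_def GQE_defect_def UhF_act_diff UhF_act_sum left_diff_distrib
          sum_distrib_right)
qed

section \<open>Transfer from the quotient ring to power series\<close>

lemma ring_of_type_algebra_simps:
  "carrier ring_of_type_algebra = UNIV"
  "x \<otimes>\<^bsub>ring_of_type_algebra\<^esub> y = x * y"
  "x \<oplus>\<^bsub>ring_of_type_algebra\<^esub> y = x + y"
  "\<one>\<^bsub>ring_of_type_algebra\<^esub> = 1"
  "\<zero>\<^bsub>ring_of_type_algebra\<^esub> = 0"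
  by (simp_all add: ring_of_type_algebra_def)

lemma ring_of_type_algebra_pow:
  "x [^]\<^bsub>ring_of_type_algebra\<^esub> (a::nat) = (x :: 'a::ring_1) ^ a"
proof -
  interpret ring "ring_of_type_algebra :: 'a ring" by (rule ring_ring_of_type_algebra)
  show ?thesis
    by (induction a) (simp_all add: ring_of_type_algebra_simps power_commutes)
qed

lemma ring_of_type_algebra_minus:
  "x \<ominus>\<^bsub>ring_of_type_algebra\<^esub> y = (x - y :: 'a::ring_1)"
proof -
  interpret ring "ring_of_type_algebra :: 'a ring" by (rule ring_ring_of_type_algebra)
  have "\<ominus>\<^bsub>ring_of_type_algebra\<^esub> y = - y"
    by (rule minus_equality) (simp_all add: ring_of_type_algebra_simps)
  then show ?thesis by (simp add: a_minus_def ring_of_type_algebra_simps)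
qed

lemma ring_hom_ring_Uh_class: "ring_hom_ring ring_of_type_algebra (Uh \<psi>) (Uh_class \<psi>)"
  using ideal.rcos_ring_hom_ring[OF ideal_UhF_annihilator[of \<psi>]]
  by (simp add: Uh_def Uh_class_def[abs_def])

lemma carrier_Uh: "carrier (Uh \<psi>) = range (Uh_class \<psi>)"
  by (auto simp: Uh_def Uh_class_def FactRing_def A_RCOSETS_def' ring_of_type_algebra_simps)

lemma Uh_class_simps:
  "Uh_class \<psi> x \<otimes>\<^bsub>Uh \<psi>\<^esub> Uh_class \<psi> y = Uh_class \<psi> (x * y)"
  "Uh_class \<psi> x \<oplus>\<^bsub>Uh \<psi>\<^esub> Uh_class \<psi> y = Uh_class \<psi> (x + y)"
  "Uh_class \<psi> x [^]\<^bsub>Uh \<psi>\<^esub> a = Uh_class \<psi> (x ^ a)" for a :: nat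
proof -
  interpret ring_hom_ring ring_of_type_algebra "Uh \<psi>" "Uh_class \<psi>"
    by (rule ring_hom_ring_Uh_class)
  show "Uh_class \<psi> x \<otimes>\<^bsub>Uh \<psi>\<^esub> Uh_class \<psi> y = Uh_class \<psi> (x * y)"
    using hom_mult[of x y] by (simp add: ring_of_type_algebra_simps)
  show "Uh_class \<psi> x \<oplus>\<^bsub>Uh \<psi>\<^esub> Uh_class \<psi> y = Uh_class \<psi> (x + y)"
    using hom_add[of x y] by (simp add: ring_of_type_algebra_simps)
  show "Uh_class \<psi> x [^]\<^bsub>Uh \<psi>\<^esub> a = Uh_class \<psi> (x ^ a)"
    using hom_nat_pow[of x a] by (simp add: ring_of_type_algebra_simps ring_of_type_algebra_pow)
qed

lemma Uh_class_sum:
  assumes "finite A"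
  shows "(\<Oplus>\<^bsub>Uh \<psi>\<^esub>a\<in>A. Uh_class \<psi> (f a)) = Uh_class \<psi> (\<Sum>a\<in>A. f a)"
proof -
  interpret ring_hom_ring ring_of_type_algebra "Uh \<psi>" "Uh_class \<psi>"
    by (rule ring_hom_ring_Uh_class)
  show ?thesis
    using assms
  proof (induction rule: finite_induct)
    case empty
    then show ?case using hom_zero by (simp add: ring_of_type_algebra_simps)
  next
    case (insert a A)
    then show ?case by (simp add: Pi_def carrier_Uh Uh_class_simps)
  qed
qed

lemma Uh_class_eq_iff: "Uh_class \<psi> x = Uh_class \<psi> y \<longleftrightarrow> x - y \<in> UhF_annihilator \<psi>"
proof -
  interpret ring "ring_of_type_algebra :: 'a Usl2F fps ring" by (rule ring_ring_of_type_algebra)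
  show ?thesis
    using quotient_eq_iff_same_a_r_cos[OF ideal_UhF_annihilator[of \<psi>], of x y]
    by (simp add: Uh_class_def ring_of_type_algebra_simps ring_of_type_algebra_minus)
qed

text \<open>The class map is a surjective ring homomorphism with kernel
  \<open>UhF_annihilator \<psi>\<close>, so sums and the witness z lift to representatives.\<close>

lemma Uh_sums_iff_annihilator:
  "Uh_sums \<psi> (\<lambda>a. Uh_class \<psi> (f a)) (Uh_class \<psi> y) \<longleftrightarrow>
     (\<forall>N. \<exists>A. \<forall>B\<ge>A. \<exists>z. y - (\<Sum>a<B. f a) - fps_X ^ N * z \<in> UhF_annihilator \<psi>)"
  unfolding Uh_sums_def carrier_Uh bex_simps
  by (simp add: Uh_class_sum Uh_class_simps Uh_class_eq_iff diff_diff_add)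

section \<open>Convergence in the quotient versus vanishing of all defects\<close>

theorem propositionA2:
  fixes \<psi> :: "'k::field_char_0 colouring"
    and M :: "nat \<Rightarrow> 'k poly fps"
  assumes "M \<longlonglongrightarrow> 0"
  shows "Uh_sums \<psi>
           (\<lambda>a. Uh_class \<psi> (UhF_gen Xminus) [^]\<^bsub>Uh \<psi>\<^esub> a
                  \<otimes>\<^bsub>Uh \<psi>\<^esub> Uh_class \<psi> (UhF_of_H (M a))
                  \<otimes>\<^bsub>Uh \<psi>\<^esub> Uh_class \<psi> (UhF_gen Xplus) [^]\<^bsub>Uh \<psi>\<^esub> a)
           (Uh_class \<psi> (UhF_gen Xplus) \<otimes>\<^bsub>Uh \<psi>\<^esub> Uh_class \<psi> (UhF_gen Xminus))
         \<longleftrightarrow> GQE_solution \<psi> M"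
    (is "?sums \<longleftrightarrow> _")
proof -
  have sums_iff: "?sums \<longleftrightarrow>
      (\<forall>N. \<exists>A. \<forall>B\<ge>A. \<exists>z. GQE_remainder M B - fps_X ^ N * z \<in> UhF_annihilator \<psi>)"
    by (simp add: Uh_class_simps Uh_sums_iff_annihilator GQE_remainder_def GQE_term_def)
  show ?thesis
    unfolding sums_iff GQE_solution_iff_defect[OF assms]
  proof (intro iffI allI impI)
    fix n p :: nat
    assume conv: "\<forall>N. \<exists>A. \<forall>B\<ge>A. \<exists>z. GQE_remainder M B - fps_X ^ N * z \<in> UhF_annihilator \<psi>"
      and "p \<le> n"
    show "GQE_defect \<psi> M n p = 0"
    proof (rule fps_ext)
      fix i
      \<comment> \<open>Divisibility by \<open>fps_X ^ Suc i\<close> is what kills coefficient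
        i.\<close>
      obtain A where "\<forall>B\<ge>A. \<exists>z. GQE_remainder M B - fps_X ^ Suc i * z \<in> UhF_annihilator \<psi>"
        using conv by blast
      \<comment> \<open>The index is past A for convergence and past p for the remainder to act by
        the defect.\<close>
      then obtain z where
        "GQE_remainder M (max A (Suc p)) - fps_X ^ Suc i * z \<in> UhF_annihilator \<psi>"
        using max.cobounded1 by blast
      then have "UhF_act \<psi> n (GQE_remainder M (max A (Suc p)) - fps_X ^ Suc i * z) (L_basis p) p = 0"
        using \<open>p \<le> n\<close> by (simp add: UhF_annihilator_iff_basis del: power_Suc)
      moreover have "UhF_act \<psi> n (GQE_remainder M (max A (Suc p))) (L_basis p) p = GQE_defect \<psi> M n p"
        using \<open>p \<le> n\<close> by (simp add: UhF_act_GQE_remainder) (simp add: L_basis_def)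
      ultimately have "GQE_defect \<psi> M n p = fps_X ^ Suc i * UhF_act \<psi> n z (L_basis p) p"
        by (simp add: UhF_act_diff UhF_act_mult UhF_act_fps_X_power del: power_Suc)
      then show "fps_nth (GQE_defect \<psi> M n p) i = fps_nth 0 i"
        by (simp add: fps_X_power_mult_nth del: power_Suc)
    qed
  next
    fix N
    assume sol: "\<forall>n p. p \<le> n \<longrightarrow> GQE_defect \<psi> M n p = 0"
    have "\<exists>A. \<forall>a\<ge>A. \<forall>i\<le>N. fps_nth (M a) i = 0" for N
    proof -
      \<comment> \<open>Convergence to 0 makes each coefficient eventually zero; finitely many are
        handled at once.\<close>
      have "\<forall>\<^sub>F a in sequentially. \<forall>i\<in>{..N}. fps_nth (M a) i = 0"
        using assms by (intro eventually_ball_finite) (auto simp: tendsto_fps_iff)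
      then show ?thesis by (auto simp: eventually_sequentially)
    qed
    then obtain c where c: "\<And>N a i. c N \<le> a \<Longrightarrow> i \<le> N \<Longrightarrow> fps_nth (M a) i = 0"
      by metis
    have stable: "fps_nth (GQE_remainder M B) i = fps_nth (GQE_remainder M (c N)) i"
      if "c N \<le> B" "i \<le> N" for N B i
    proof -
      have "(\<Sum>a<B. fps_nth (GQE_term M a) i) = (\<Sum>a<c N. fps_nth (GQE_term M a) i)"
        using that by (intro sum.mono_neutral_right) (auto intro!: GQE_term_nth_eq_0 c)
      then show ?thesis by (simp add: GQE_remainder_def fps_sum_nth)
    qed
    \<comment> \<open>The h-adic limit of the remainders, built diagonally from the stages where
      each coefficient has settled.\<close>
    define d where "d = Abs_fps (\<lambda>i. fps_nth (GQE_remainder M (c i)) i)"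
    have d: "fps_nth d i = fps_nth (GQE_remainder M B) i" if "c N \<le> B" "i \<le> N" for N B i
      \<comment> \<open>\<open>c\<close> need not be monotone, so the stages B and
        \<open>c i\<close> are compared through their maximum.\<close>
      using stable[of N "max B (c i)" i] stable[of N B i] stable[of i "max B (c i)" i] that
      by (simp add: d_def)
    have "UhF_act \<psi> n d (L_basis p) = vzero" if "p \<le> n" for n p
    proof (intro ext fps_ext)
      fix q N
      \<comment> \<open>\<open>c N\<close> gives agreement with d up to coefficient N;
        \<open>Suc p\<close> makes the remainder act by the defect, which is zero.\<close>
      have "fps_nth (UhF_act \<psi> n d (L_basis p) q) N =
          fps_nth (UhF_act \<psi> n (GQE_remainder M (max (c N) (Suc p))) (L_basis p) q) N"
        by (intro UhF_act_cong_nth d) auto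
      then show "fps_nth (UhF_act \<psi> n d (L_basis p) q) N = fps_nth (vzero q) N"
        using that sol by (simp add: UhF_act_GQE_remainder)
    qed
    then have "d \<in> UhF_annihilator \<psi>"
      by (simp add: UhF_annihilator_iff_basis)
    \<comment> \<open>Remainder and d agree below degree N, so their difference is
      \<open>fps_X ^ N\<close> times its shift; the shift is the witness z.\<close>
    moreover have "GQE_remainder M B - fps_X ^ N * fps_shift N (GQE_remainder M B - d) = d"
      if "c N \<le> B" for B
      using d[OF that] by (auto simp: fps_eq_iff fps_X_power_mult_nth)
    ultimately show "\<exists>A. \<forall>B\<ge>A. \<exists>z. GQE_remainder M B - fps_X ^ N * z \<in> UhF_annihilator \<psi>"
      by metis
  qed
qed

end
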